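(* Let $G$ be a unicyclic graph of order $n\ge 3$ with girth $g$. Then $$EUS(G)\geq \begin{cases} 2\sqrt{3}\,n & \text{if } g=n,\\ 2\sqrt{3}\,(n-3)+2\sqrt{19}+\sqrt{13} & \text{if } g=n-1,\\ 3\sqrt{19}+2(n-4)\sqrt{3}+\sqrt{7} & \text{if } g\le n-2,\end{cases}$$ with equality if and only if $G\cong C_n$ (for $g=n$), $G\cong C_{n,n-1}$ (for $g=n-1$), or $G\cong C_{n,g}$ (for $g\le n-2$).
   Context: For a simple graph $G$, the Euler Sombor index is $EUS(G)=\sum_{v_iv_j\in E(G)}\sqrt{d_i^2+d_j^2+d_id_j}$, where $d_i$ denotes the degree of vertex $v_i$. A unicyclic graph is a connected graph with the same number of edges as vertices; its girth is the length of its unique cycle. $C_n$ is the cycle on $n$ vertices. For $g<n$, $C_{n,g}$ denotes the unicyclic graph of order $n$ and girth $g$ obtained by attaching a pendant path $P_{n-g}$ (on $n-g$ new vertices) to a single vertex of the cycle $C_g$ by an edge. *)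

theory Defs
  imports Complex_Main "Graph_Theory.Graph_Theory"
begin

text \<open>
  A finite simple graph is a \<open>pair_graph\<close>: a finite loop-free symmetric digraph whose arcs are
  pairs of vertices. An undirected edge is thus represented by two opposite arcs.
\<close>

definition edges :: "'a pair_pre_digraph \<Rightarrow> 'a set set" where
  "edges G = (\<lambda>(u, v). {u, v}) ` parcs G"

text \<open>In a symmetric digraph the out-degree of a vertex is its degree in the undirected sense.\<close>

abbreviation degree :: "'a pair_pre_digraph \<Rightarrow> 'a \<Rightarrow> nat" where
  "degree G v \<equiv> out_degree (with_proj G) v"

definition EUS :: "'a pair_pre_digraph \<Rightarrow> real" where
  "EUS G = (\<Sum>e\<in>edges G. sqrt ((\<Sum>v\<in>e. (real (degree G v))\<^sup>2) + (\<Prod>v\<in>e. real (degree G v))))"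

text \<open>Since an edge of a simple graph has two distinct ends, the summand is the expected one.\<close>

lemma EUS_summand:
  assumes "u \<noteq> v"
  shows "sqrt ((\<Sum>w\<in>{u, v}. (real (degree G w))\<^sup>2) + (\<Prod>w\<in>{u, v}. real (degree G w)))
    = sqrt ((real (degree G u))\<^sup>2 + (real (degree G v))\<^sup>2 + real (degree G u) * real (degree G v))"
  using assms by simp

definition unicyclic :: "'a pair_pre_digraph \<Rightarrow> bool" where
  "unicyclic G \<longleftrightarrow> pair_graph G \<and> connected (with_proj G) \<and> card (edges G) = card (pverts G)"

text \<open>
  A directed cycle of length at least 3; the bound rules out the closed walk that
  traverses a single edge back and forth, which is a cycle of the symmetric digraph.
\<close>

definition undirected_cycle :: "'a pair_pre_digraph \<Rightarrow> ('a \<times> 'a) list \<Rightarrow> bool" where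
  "undirected_cycle G p \<longleftrightarrow> pre_digraph.cycle (with_proj G) p \<and> 3 \<le> length p"

text \<open>
  Meaningful for unicyclic graphs only. The arc lists of a cycle differ by starting point and
  orientation, but share their length.
\<close>

definition girth :: "'a pair_pre_digraph \<Rightarrow> nat" where
  "girth G = (THE k. \<exists>p. undirected_cycle G p \<and> length p = k)"

definition cycle_arcs :: "nat \<Rightarrow> (nat \<times> nat) set" where
  "cycle_arcs m = {(i, Suc i mod m) | i. i < m}"

definition cycle_graph :: "nat \<Rightarrow> nat pair_pre_digraph" where
  "cycle_graph n = \<lparr> pverts = {..<n}, parcs = cycle_arcs n \<union> (cycle_arcs n)\<inverse> \<rparr>"

text \<open>
  \<open>C\<^bsub>n,g\<^esub>\<close> for \<open>3 \<le> g < n\<close>: the cycle lives on \<open>0, \<dots>, g - 1\<close>, the pendant path on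
  \<open>g, \<dots>, n - 1\<close>, and \<open>(0, g)\<close> is the edge attaching the path to the cycle.
\<close>

definition cycle_pendant_path :: "nat \<Rightarrow> nat \<Rightarrow> nat pair_pre_digraph" where
  "cycle_pendant_path n g =
    (let A = cycle_arcs g \<union> {(0, g)} \<union> {(i, Suc i) | i. g \<le> i \<and> Suc i < n}
     in \<lparr> pverts = {..<n}, parcs = A \<union> A\<inverse> \<rparr>)"

lemma mod_Suc_neq: "3 \<le> m \<Longrightarrow> i < m \<Longrightarrow> i \<noteq> Suc i mod m"
  by (cases "Suc i = m") auto

lemma pair_graph_cycle_graph:
  assumes "3 \<le> n"
  shows "pair_graph (cycle_graph n)"
  using assms
  by unfold_locales
    (auto simp: cycle_graph_def cycle_arcs_def symmetric_def sym_def dest: mod_Suc_neq)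

lemma pair_graph_cycle_pendant_path:
  assumes "3 \<le> g" "g < n"
  shows "pair_graph (cycle_pendant_path n g)"
proof -
  have "Suc i mod g < n" for i
    using assms by (meson less_trans mod_less_divisor less_le_trans zero_less_numeral)
  moreover have "finite {(i, Suc i) | i. g \<le> i \<and> Suc i < n}"
    by (rule finite_subset[of _ "{..<n} \<times> {..<n}"]) auto
  ultimately show ?thesis
    using assms
    by unfold_locales
      (auto simp: cycle_pendant_path_def cycle_arcs_def symmetric_def sym_def Let_def
        dest: mod_Suc_neq)
qed

end

theory Submission
  imports Defs
begin

text \<open>
  As \<open>sqrt (a\<^sup>2 + b\<^sup>2 + a * b) \<ge> sqrt 3 / 2 * (a + b)\<close>, the index is at least \<open>sqrt 3 / 2\<close> times the
  sum of the squared degrees. The degrees of a unicyclic graph sum to \<open>2 * n\<close>, so the sum of their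
  squares is \<open>4 * n\<close> plus the sum of the \<open>(d - 2)\<^sup>2\<close>. If the latter is at least \<open>4\<close>, the index is at
  least \<open>2 * sqrt 3 * n + 2 * sqrt 3\<close>, which exceeds the bounds for \<open>g < n\<close>. Otherwise at most one
  vertex has degree \<open>3\<close> and all others have degree at most \<open>2\<close>, which leaves only the cycle and the
  cycle with a pendant path, for which the index is computed.
\<close>

section \<open>Cycles in finite graphs\<close>

text \<open>The image from \<open>edges\<close>, taken of a bare relation, so that edges and
  vertices can be deleted without rebuilding a graph record.\<close>

definition uedges :: "'a rel \<Rightarrow> 'a set set" where
  "uedges E = (\<lambda>(u, v). {u, v}) ` E"

text \<open>A cycle is a list of vertices rather than of arcs: rotating the list moves the starting
  point, and the index modulo the length covers the closing arc.\<close>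

definition is_cycle :: "'a rel \<Rightarrow> 'a list \<Rightarrow> bool" where
  "is_cycle E cs \<longleftrightarrow> 3 \<le> length cs \<and> distinct cs \<and>
    (\<forall>i<length cs. (cs ! i, cs ! (Suc i mod length cs)) \<in> E)"

lemma is_cycle_rotate:
  assumes "is_cycle E cs"
  shows "is_cycle E (rotate m cs)"
proof -
  let ?k = "length cs"
  have "(rotate m cs ! i, rotate m cs ! (Suc i mod ?k)) \<in> E" if "i < ?k" for i
  proof -
    have "(cs ! ((m + i) mod ?k), cs ! (Suc ((m + i) mod ?k) mod ?k)) \<in> E"
      using assms mod_less_divisor[of ?k "m + i"] that unfolding is_cycle_def by fastforce
    moreover have "Suc i mod ?k < ?k"
      using that by (intro mod_less_divisor) auto
    ultimately show ?thesis
      using that by (simp add: nth_rotate mod_simps)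
  qed
  then show ?thesis
    using assms by (simp add: is_cycle_def)
qed

lemma is_cycle_mono: "is_cycle E cs \<Longrightarrow> E \<subseteq> F \<Longrightarrow> is_cycle F cs"
  by (auto simp: is_cycle_def)

text \<open>If two positions gave the same edge, each would be the cyclic successor of the other,
  which is impossible with at least 3 positions.\<close>

lemma card_cycle_edges:
  assumes "3 \<le> length cs" "distinct cs"
  shows "card ((\<lambda>i. {cs ! i, cs ! (Suc i mod length cs)}) ` {..<length cs}) = length cs"
proof -
  let ?k = "length cs"
  have "i = j" if "i < ?k" "j < ?k"
    and eq: "{cs ! i, cs ! (Suc i mod ?k)} = {cs ! j, cs ! (Suc j mod ?k)}" for i j
  proof (rule ccontr)
    assume "i \<noteq> j"
    then have ne: "cs ! i \<noteq> cs ! j"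
      using that assms by (simp add: nth_eq_iff_index_eq)
    have lt: "Suc i mod ?k < ?k" "Suc j mod ?k < ?k"
      using assms by (auto intro: mod_less_divisor)
    have "cs ! i = cs ! (Suc j mod ?k)" "cs ! j = cs ! (Suc i mod ?k)"
      using eq ne by (auto simp: doubleton_eq_iff)
    then have "i = Suc j mod ?k" "j = Suc i mod ?k"
      using that lt assms by (simp_all add: nth_eq_iff_index_eq)
    moreover have "Suc l mod ?k = (if Suc l = ?k then 0 else Suc l)" if "l < ?k" for l
      using that by auto
    ultimately show False
      using that(1,2) assms(1) by (auto split: if_splits)
  qed
  then have "inj_on (\<lambda>i. {cs ! i, cs ! (Suc i mod ?k)}) {..<?k}"
    by (auto simp: inj_on_def)
  then show ?thesis
    by (simp add: card_image)
qed

section \<open>Degree sums, edge counts and connectivity\<close>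

locale finite_graph =
  fixes V :: "'a set" and E :: "'a rel"
  assumes finite_V: "finite V"
    and E_sub: "E \<subseteq> V \<times> V"
    and sym_E: "sym E"
    and irrefl_E: "irrefl E"
begin

abbreviation deg :: "'a \<Rightarrow> nat" where
  "deg v \<equiv> card (E `` {v})"

lemma finite_E: "finite E"
  using finite_V E_sub by (meson finite_SigmaI finite_subset)

lemma finite_nbrs [simp]: "finite (E `` {v})"
  using finite_E by (simp add: finite_Image)

lemma E_swap: "(u, v) \<in> E \<longleftrightarrow> (v, u) \<in> E"
  using sym_E by (meson symE)

lemma E_neq: "(u, v) \<in> E \<Longrightarrow> u \<noteq> v"
  using irrefl_E by (auto simp: irrefl_def)

text \<open>Arcs are grouped by their tail. Constant \<open>h\<close> gives the handshake lemma, and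
  \<open>h\<close> equal to the degree gives the sum of the squared degrees.\<close>

lemma sum_arcs_fst:
  fixes h :: "'a \<Rightarrow> 'b::comm_semiring_1"
  shows "(\<Sum>(u, v)\<in>E. h u) = (\<Sum>u\<in>V. of_nat (deg u) * h u)"
proof -
  have E: "E = (SIGMA u:V. E `` {u})"
    using E_sub by auto
  have "(\<Sum>u\<in>V. of_nat (deg u) * h u) = (\<Sum>u\<in>V. \<Sum>v\<in>E `` {u}. h u)"
    by simp
  also have "\<dots> = (\<Sum>(u, v)\<in>(SIGMA u:V. E `` {u}). h u)"
    using finite_V by (intro sum.Sigma) auto
  finally show ?thesis
    using E by simp
qed

lemma sum_arcs_edges:
  fixes h :: "'a set \<Rightarrow> 'b::comm_semiring_1"
  shows "(\<Sum>(u, v)\<in>E. h {u, v}) = 2 * (\<Sum>e\<in>uedges E. h e)"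
proof -
  have "(\<Sum>(u, v)\<in>E. h {u, v}) =
      (\<Sum>e\<in>uedges E. \<Sum>(u, v)\<in>{a \<in> E. (\<lambda>(u, v). {u, v}) a = e}. h {u, v})"
    unfolding uedges_def by (rule sum.image_gen[OF finite_E])
  also have "\<dots> = (\<Sum>e\<in>uedges E. 2 * h e)"
  proof (rule sum.cong)
    fix e assume "e \<in> uedges E"
    then obtain a b where ab: "(a, b) \<in> E" "e = {a, b}"
      by (auto simp: uedges_def)
    then have "{a \<in> E. (\<lambda>(u, v). {u, v}) a = e} = {(a, b), (b, a)}"
      using E_swap by (auto simp: doubleton_eq_iff)
    moreover have "a \<noteq> b"
      using ab E_neq by auto
    ultimately show "(\<Sum>(u, v)\<in>{a \<in> E. (\<lambda>(u, v). {u, v}) a = e}. h {u, v}) = 2 * h e"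
      using ab by (simp add: insert_commute mult_2)
  qed simp
  finally show ?thesis
    by (simp add: sum_distrib_left)
qed

lemma card_arcs: "card E = 2 * card (uedges E)"
  using sum_arcs_edges[of "\<lambda>_. 1::nat"] by (simp add: case_prod_unfold)

lemma sum_deg: "(\<Sum>v\<in>V. deg v) = 2 * card (uedges E)"
  using sum_arcs_fst[of "\<lambda>_. 1::nat"] card_arcs by (simp add: case_prod_unfold)

lemma finite_graph_remove_edge: "finite_graph V (E - {(a, b), (b, a)})"
  using finite_V E_sub sym_E irrefl_E
  by unfold_locales (auto simp: sym_def irrefl_def)

lemma card_uedges_remove_edge:
  assumes "(a, b) \<in> E"
  shows "Suc (card (uedges (E - {(a, b), (b, a)}))) = card (uedges E)"
proof -
  interpret R: finite_graph V "E - {(a, b), (b, a)}"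
    by (rule finite_graph_remove_edge)
  have "(b, a) \<in> E" "a \<noteq> b"
    using assms E_swap E_neq by blast+
  then have "card {(a, b), (b, a)} = 2" "{(a, b), (b, a)} \<subseteq> E"
    using assms by auto
  then have "card (E - {(a, b), (b, a)}) = card E - 2" "2 \<le> card E"
    using finite_E by (simp add: card_Diff_subset, metis card_mono)
  then show ?thesis
    using card_arcs R.card_arcs by simp
qed

text \<open>Sending every vertex other than a root to the first edge of a shortest path to the root
  is injective.\<close>

lemma card_verts_le_connected:
  assumes "r \<in> V" and reach: "\<And>v. v \<in> V \<Longrightarrow> (v, r) \<in> E\<^sup>*"
  shows "card V \<le> Suc (card (uedges E))"
proof -
  define dist where "dist v = (LEAST m. (v, r) \<in> E ^^ m)" for v
  have dist: "(v, r) \<in> E ^^ dist v" if "v \<in> V" for v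
    unfolding dist_def using reach[OF that] by (metis LeastI rtrancl_imp_relpow)
  have "\<exists>w. (v, w) \<in> E \<and> dist w < dist v" if "v \<in> V - {r}" for v
  proof (cases "dist v")
    case 0
    then show ?thesis
      using dist[of v] that by auto
  next
    case (Suc m)
    then have "(v, r) \<in> E ^^ Suc m"
      using dist[of v] that by auto
    then obtain w where w: "(v, w) \<in> E" "(w, r) \<in> E ^^ m"
      by (meson relpow_Suc_E2)
    then have "dist w \<le> m"
      unfolding dist_def by (simp add: Least_le)
    then show ?thesis
      using w Suc by auto
  qed
  then obtain par where par: "\<And>v. v \<in> V - {r} \<Longrightarrow> (v, par v) \<in> E \<and> dist (par v) < dist v"
    by metis
  have "inj_on (\<lambda>v. {v, par v}) (V - {r})"
  proof (rule inj_onI)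
    fix v w assume vw: "v \<in> V - {r}" "w \<in> V - {r}" and "{v, par v} = {w, par w}"
    then have "v = w \<or> v = par w \<and> w = par v"
      by (auto simp: doubleton_eq_iff)
    then show "v = w"
      using par vw by (metis less_asym)
  qed
  moreover have "(\<lambda>v. {v, par v}) ` (V - {r}) \<subseteq> uedges E"
    using par by (auto simp: uedges_def)
  moreover have "finite (uedges E)"
    by (simp add: uedges_def finite_E)
  ultimately have "card (V - {r}) \<le> card (uedges E)"
    by (metis card_image card_mono)
  then show ?thesis
    using assms finite_V by (simp add: card_Diff_singleton)
qed

text \<open>The rest of the cycle is a path that still joins the two ends of the deleted
  edge.\<close>

lemma rtrancl_remove_cycle_edge:
  assumes "is_cycle E cs" "i < length cs"
    and a: "a = cs ! i" and b: "b = cs ! (Suc i mod length cs)"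
  shows "(E - {(a, b), (b, a)})\<^sup>* = E\<^sup>*"
proof -
  let ?E = "E - {(a, b), (b, a)}" and ?k = "length cs"
  \<comment> \<open>After this rotation the deleted edge is the closing one, from the last entry
    \<open>a\<close> to the first entry \<open>b\<close>.\<close>
  define ds where "ds = rotate (Suc i) cs"
  have ds: "is_cycle E ds" and len: "length ds = ?k"
    using is_cycle_rotate[OF assms(1)] by (simp_all only: ds_def length_rotate)
  have k3: "3 \<le> ?k" and dist: "distinct ds"
    using ds len by (auto simp: is_cycle_def)
  have "ds ! 0 = b"
    unfolding ds_def b using k3 by (subst nth_rotate) auto
  have "Suc i + (?k - 1) = i + ?k"
    using assms(2) by simp
  then have "(Suc i + (?k - 1)) mod ?k = i"
    using assms(2) by (simp only: mod_add_self2 mod_less)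
  then have "ds ! (?k - 1) = a"
    unfolding ds_def a using k3 by (subst nth_rotate) simp_all
  have step: "(ds ! j, ds ! Suc j) \<in> ?E" if "Suc j < ?k" for j
  proof -
    have "(ds ! j, ds ! Suc j) \<in> E"
      using ds that len Suc_lessD[OF that] mod_less[OF that] unfolding is_cycle_def by metis
    moreover have "(ds ! j, ds ! Suc j) \<noteq> (ds ! (?k - 1), ds ! 0)"
      using dist len that by (simp add: nth_eq_iff_index_eq)
    \<comment> \<open>The reversed closing arc could only occur at \<open>j = 0\<close> with
      \<open>Suc j = ?k - 1\<close>, that is, in a cycle of length 2.\<close>
    moreover have "(ds ! j, ds ! Suc j) \<noteq> (ds ! 0, ds ! (?k - 1))"
    proof
      assume "(ds ! j, ds ! Suc j) = (ds ! 0, ds ! (?k - 1))"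
      then have "j = 0" "Suc j = ?k - 1"
        using nth_eq_iff_index_eq[OF dist, of j 0] nth_eq_iff_index_eq[OF dist, of "Suc j" "?k - 1"]
          len that k3 by (simp_all del: length_greater_0_conv One_nat_def)
      then show False
        using k3 by simp
    qed
    ultimately show ?thesis
      using \<open>ds ! 0 = b\<close> \<open>ds ! (?k - 1) = a\<close> by auto
  qed
  have "(ds ! 0, ds ! j) \<in> ?E\<^sup>*" if "j < ?k" for j
    using that
  proof (induction j)
    case (Suc j)
    then show ?case
      using step[of j] by (meson Suc_lessD rtrancl_into_rtrancl)
  qed simp
  from this[of "?k - 1"] have ba: "(b, a) \<in> ?E\<^sup>*"
    using \<open>ds ! 0 = b\<close> \<open>ds ! (?k - 1) = a\<close> k3 by simp
  moreover have "sym (?E\<^sup>*)"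
    using finite_graph.sym_E[OF finite_graph_remove_edge] by (rule sym_rtrancl)
  ultimately have "(a, b) \<in> ?E\<^sup>*"
    by (meson symE)
  with ba have "E \<subseteq> ?E\<^sup>*"
    by auto
  then show ?thesis
    by (intro rtrancl_subset[symmetric]) auto
qed

text \<open>Without one of its cycle edges the graph is still connected, so at least
  \<open>card V - 1\<close> other edges remain.\<close>

lemma card_verts_le_card_edges_if_cycle:
  assumes "is_cycle E cs" and "V \<noteq> {}" and conn: "V \<times> V \<subseteq> E\<^sup>*"
  shows "card V \<le> card (uedges E)"
proof -
  let ?a = "cs ! 0" and ?b = "cs ! (Suc 0 mod length cs)"
  have 0: "0 < length cs"
    using assms by (auto simp: is_cycle_def)
  interpret R: finite_graph V "E - {(?a, ?b), (?b, ?a)}"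
    by (rule finite_graph_remove_edge)
  obtain r where "r \<in> V"
    using assms(2) by auto
  have "card V \<le> Suc (card (uedges (E - {(?a, ?b), (?b, ?a)})))"
    unfolding rtrancl_remove_cycle_edge[OF assms(1) 0 refl refl, symmetric]
    by (rule R.card_verts_le_connected[OF \<open>r \<in> V\<close>],
        unfold rtrancl_remove_cycle_edge[OF assms(1) 0 refl refl]) (use conn \<open>r \<in> V\<close> in auto)
  also have "\<dots> = card (uedges E)"
    using assms(1) 0 unfolding is_cycle_def by (blast intro: card_uedges_remove_edge)
  finally show ?thesis .
qed

text \<open>A longer cycle has an edge off the shorter one. Deleting it leaves a connected graph that
  still contains a cycle, hence has at least \<open>card V\<close> edges.\<close>

lemma unicyclic_cycle_length_le:
  assumes conn: "V \<times> V \<subseteq> E\<^sup>*" and "V \<noteq> {}" and card: "card (uedges E) \<le> card V"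
    and cs: "is_cycle E cs" and ds: "is_cycle E ds"
  shows "length cs \<le> length ds"
proof (rule ccontr)
  let ?e = "\<lambda>cs i. {cs ! i, cs ! (Suc i mod length cs)}"
  assume "\<not> length cs \<le> length ds"
  then have "card (?e ds ` {..<length ds}) < card (?e cs ` {..<length cs})"
    using cs ds by (simp add: card_cycle_edges is_cycle_def)
  then obtain i where i: "i < length cs" "?e cs i \<notin> ?e ds ` {..<length ds}"
    by (meson card_mono finite_imageI finite_lessThan image_subsetI lessThan_iff not_le)
  define a b where "a = cs ! i" and "b = cs ! (Suc i mod length cs)"
  interpret R: finite_graph V "E - {(a, b), (b, a)}"
    by (rule finite_graph_remove_edge)
  have "(ds ! j, ds ! (Suc j mod length ds)) \<in> E - {(a, b), (b, a)}" if "j < length ds" for j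
  proof -
    have "?e ds j \<noteq> {a, b}"
      using i(2) that unfolding a_def b_def by fastforce
    then show ?thesis
      using ds that by (auto simp: is_cycle_def)
  qed
  then have "is_cycle (E - {(a, b), (b, a)}) ds"
    using ds by (simp add: is_cycle_def)
  then have "card V \<le> card (uedges (E - {(a, b), (b, a)}))"
    using assms rtrancl_remove_cycle_edge[OF cs i(1) a_def b_def]
    by (intro R.card_verts_le_card_edges_if_cycle) auto
  moreover have "(a, b) \<in> E"
    using cs i by (simp add: is_cycle_def a_def b_def)
  ultimately show False
    using card_uedges_remove_edge card by fastforce
qed

text \<open>Serves twice: contrapositively it yields an arc that leaves a cycle missing some vertex,
  and directly it shows that the cycle together with its pendant path fills the graph.\<close>

lemma closed_set_eq_verts:
  assumes "V \<times> V \<subseteq> E\<^sup>*" and "S \<subseteq> V" and "S \<noteq> {}" and "E `` S \<subseteq> S"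
  shows "S = V"
proof -
  obtain s where "s \<in> S"
    using assms by auto
  have "v \<in> S" if "(s, v) \<in> E\<^sup>*" for v
    using that by induction (use \<open>s \<in> S\<close> assms(4) in auto)
  then show ?thesis
    using assms(1,2) \<open>s \<in> S\<close> by blast
qed

lemma cycle_subset_verts: "is_cycle E cs \<Longrightarrow> set cs \<subseteq> V"
  using E_sub by (fastforce simp: is_cycle_def in_set_conv_nth)

text \<open>With \<open>v\<close> rotated to the front, its neighbours on the cycle are the second
  and the last entry, distinct because the length is at least 3. They form a set \<open>N\<close> so
  that it can be compared with the neighbourhood by cardinality.\<close>

lemma cycle_nbrs:
  assumes cs: "is_cycle E cs" and "v \<in> set cs"
  obtains N where "N \<subseteq> E `` {v}" "N \<subseteq> set cs" "card N = 2"
proof -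
  obtain i where i: "i < length cs" "v = cs ! i"
    using assms by (auto simp: in_set_conv_nth)
  define ds where "ds = rotate i cs"
  have ds: "is_cycle E ds" "set ds = set cs"
    using is_cycle_rotate[OF cs] by (simp_all add: ds_def)
  then have k: "3 \<le> length ds" "distinct ds"
    and E: "\<And>j. j < length ds \<Longrightarrow> (ds ! j, ds ! (Suc j mod length ds)) \<in> E"
    by (auto simp: is_cycle_def)
  have v: "ds ! 0 = v"
    unfolding ds_def i(2) using i(1) by (subst nth_rotate) auto
  have "(ds ! 0, ds ! 1) \<in> E" "(ds ! (length ds - 1), ds ! 0) \<in> E"
    using E[of 0] E[of "length ds - 1"] k(1) by (auto simp del: length_greater_0_conv)
  then have "{ds ! 1, ds ! (length ds - 1)} \<subseteq> E `` {v}"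
    using v E_swap by auto
  moreover have "{ds ! 1, ds ! (length ds - 1)} \<subseteq> set cs"
    unfolding ds(2)[symmetric] using k(1) by auto
  moreover have "card {ds ! 1, ds ! (length ds - 1)} = 2"
    using k by (simp add: nth_eq_iff_index_eq)
  ultimately show thesis
    using that by blast
qed

text \<open>On a longest path, all neighbours of the first vertex lie on the path. One of them is
  not the second vertex, and the edge to it closes a cycle.\<close>

lemma cycle_if_min_deg_2:
  assumes "V \<noteq> {}" and deg: "\<And>v. v \<in> V \<Longrightarrow> 2 \<le> deg v"
  shows "\<exists>cs. is_cycle E cs"
proof -
  define P where "P xs \<longleftrightarrow> xs \<noteq> [] \<and> distinct xs \<and> set xs \<subseteq> V \<and> successively (\<lambda>u v. (u, v) \<in> E) xs"
    for xs
  obtain r where "r \<in> V"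
    using assms by auto
  then have "P [r]"
    by (simp add: P_def)
  moreover have "\<forall>xs. P xs \<longrightarrow> length xs < Suc (card V)"
    unfolding P_def using card_mono[OF finite_V] distinct_card by (metis le_imp_less_Suc)
  ultimately have "\<exists>xs. P xs \<and> (\<forall>ys. P ys \<longrightarrow> length ys \<le> length xs)"
    by (rule ex_has_greatest_nat)
  then obtain xs where xs: "P xs" and max: "\<And>ys. P ys \<Longrightarrow> length ys \<le> length xs"
    by blast
  have nbrs: "y \<in> set xs" if "(hd xs, y) \<in> E" for y
  proof (rule ccontr)
    assume "y \<notin> set xs"
    moreover have "(y, hd xs) \<in> E"
      using that E_swap by blast
    ultimately have "P (y # xs)"
      using xs E_sub by (cases xs) (auto simp: P_def)
    then show False
      using max by fastforce
  qed
  have "hd xs \<in> V"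
    using xs by (cases xs) (auto simp: P_def)
  then have "2 \<le> deg (hd xs)"
    by (rule deg)
  \<comment> \<open>If \<open>xs\<close> is a singleton, \<open>xs ! 1\<close> is an arbitrary
    value. This is harmless, since two neighbours never fit into a one-element set.\<close>
  then have "\<not> E `` {hd xs} \<subseteq> {xs ! 1}"
    using card_mono[of "{xs ! 1}" "E `` {hd xs}"] by auto
  then obtain y where y: "(hd xs, y) \<in> E" "y \<noteq> xs ! 1"
    by auto
  then obtain j where j: "j < length xs" "y = xs ! j"
    using nbrs by (auto simp: in_set_conv_nth)
  have hd: "hd xs = xs ! 0"
    using xs by (simp add: P_def hd_conv_nth)
  have "j \<noteq> 0" "j \<noteq> 1"
    using y j hd E_neq[of "xs ! 0" "xs ! j"] by (auto intro: gr0I)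
  then have "2 \<le> j"
    by simp
  have E: "(xs ! i, xs ! Suc i) \<in> E" if "Suc i < length xs" for i
    using xs that by (simp add: P_def successively_conv_nth)
  have "(take (Suc j) xs ! i, take (Suc j) xs ! (Suc i mod Suc j)) \<in> E" if "i < Suc j" for i
    using that j y hd E[of i] E_swap by (cases "i = j") auto
  then have "is_cycle E (take (Suc j) xs)"
    using xs j \<open>2 \<le> j\<close> by (simp add: is_cycle_def P_def)
  then show ?thesis ..
qed

lemma finite_graph_remove_vertex: "finite_graph (V - {x}) (E \<inter> (V - {x}) \<times> (V - {x}))"
  using finite_V sym_E irrefl_E
  by unfold_locales (auto simp: sym_def irrefl_def)

text \<open>An arc avoids \<open>x\<close>, starts at \<open>x\<close> or ends at \<open>x\<close>.
  The last two kinds number \<open>deg x\<close> each and together stand for \<open>deg x\<close>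
  edges.\<close>

lemma card_uedges_remove_vertex:
  "card (uedges E) \<le> card (uedges (E \<inter> (V - {x}) \<times> (V - {x}))) + deg x"
proof -
  interpret R: finite_graph "V - {x}" "E \<inter> (V - {x}) \<times> (V - {x})"
    by (rule finite_graph_remove_vertex)
  let ?E = "E \<inter> (V - {x}) \<times> (V - {x})" and ?N = "E `` {x}"
  have "E \<subseteq> ?E \<union> {x} \<times> ?N \<union> ?N \<times> {x}"
    using E_sub E_swap by auto
  then have "card E \<le> card (?E \<union> {x} \<times> ?N \<union> ?N \<times> {x})"
    using R.finite_E by (intro card_mono) auto
  also have "\<dots> \<le> card ?E + card ({x} \<times> ?N) + card (?N \<times> {x})"
    by (meson add_mono card_Un_le le_trans order_refl)
  also have "\<dots> = card ?E + 2 * deg x"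
    by (simp add: card_cartesian_product)
  finally show ?thesis
    using card_arcs R.card_arcs by simp
qed

end

text \<open>Removing a vertex of degree at most 1 loses at most one edge, so the inequality
  survives. When no such vertex is left, the minimum degree is at least 2.\<close>

lemma cycle_exists:
  assumes "finite_graph V E" and "V \<noteq> {}" and "card V \<le> card (uedges E)"
  shows "\<exists>cs. is_cycle E cs"
  using assms
proof (induction "card V" arbitrary: V E rule: less_induct)
  case less
  interpret finite_graph V E
    by fact
  show ?case
  proof (cases "\<forall>v\<in>V. 2 \<le> deg v")
    case True
    then show ?thesis
      using less.prems(2) by (intro cycle_if_min_deg_2) auto
  next
    case False
    then obtain x where x: "x \<in> V" "deg x \<le> 1"
      by (auto simp: not_le)
    let ?V = "V - {x}" and ?E = "E \<inter> (V - {x}) \<times> (V - {x})"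
    have "?V \<noteq> {}"
    proof
      assume "?V = {}"
      then have "V = {x}"
        using x by auto
      then have "E = {}"
        using E_sub E_neq by fast
      then show False
        using less.prems \<open>V = {x}\<close> by (simp add: uedges_def)
    qed
    moreover have "card ?V < card V" "card V = Suc (card ?V)"
      using card_Suc_Diff1[OF finite_V x(1)] by simp_all
    moreover have "card ?V \<le> card (uedges ?E)"
      using card_uedges_remove_vertex[of x] x less.prems(3) \<open>card V = Suc (card ?V)\<close> by linarith
    ultimately have "\<exists>cs. is_cycle ?E cs"
      using finite_graph_remove_vertex by (intro less.hyps) auto
    then show ?thesis
      using is_cycle_mono by blast
  qed
qed

section \<open>Graphs isomorphic to a cycle with a pendant path\<close>

text \<open>Isolates the closing arc, the only one at which \<open>mod\<close> has an
  effect.\<close>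

lemma cycle_arcs_eq:
  assumes "0 < g"
  shows "cycle_arcs g = insert (g - 1, 0) ((\<lambda>i. (i, Suc i)) ` {..<g - 1})"
proof -
  have "cycle_arcs g = (\<lambda>i. (i, Suc i mod g)) ` insert (g - 1) {..<g - 1}"
  proof -
    have "insert (g - 1) {..<g - 1} = {..<g}"
      using assms by auto
    then show ?thesis
      by (auto simp: cycle_arcs_def)
  qed
  also have "\<dots> = insert (g - 1, Suc (g - 1) mod g) ((\<lambda>i. (i, Suc i)) ` {..<g - 1})"
    by auto
  finally show ?thesis
    using assms by simp
qed

text \<open>One arc for each edge of \<open>C\<^bsub>n,g\<^esub>\<close>: as the attaching edge joins \<open>g\<close> to \<open>0\<close> instead of
  \<open>g - 1\<close>, this is the path \<open>0, \<dots>, n - 1\<close> with its edge \<open>{g - 1, g}\<close> replaced by two chords.\<close>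

definition pendant_arcs :: "nat \<Rightarrow> nat \<Rightarrow> nat rel" where
  "pendant_arcs n g = {(g - 1, 0), (0, g)} \<union> (\<lambda>i. (i, Suc i)) ` ({..<n - 1} - {g - 1})"

lemma cycle_pendant_path_arcs:
  assumes "3 \<le> g" "g < n"
  shows "parcs (cycle_pendant_path n g) = pendant_arcs n g \<union> (pendant_arcs n g)\<inverse>"
proof -
  have "cycle_arcs g \<union> {(0, g)} \<union> {(i, Suc i) |i. g \<le> i \<and> Suc i < n} = pendant_arcs n g"
    unfolding pendant_arcs_def using assms by (subst cycle_arcs_eq) (auto simp: image_iff)
  then show ?thesis
    by (simp add: cycle_pendant_path_def Let_def)
qed

lemma sum_pendant_arcs:
  fixes F :: "nat \<times> nat \<Rightarrow> 'b::comm_monoid_add"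
  assumes "3 \<le> g" "g < n"
  shows "sum F (pendant_arcs n g) =
    F (g - 1, 0) + (F (0, g) + (\<Sum>i\<in>{..<n - 1} - {g - 1}. F (i, Suc i)))"
proof -
  have "(g - 1, 0) \<notin> insert (0, g) ((\<lambda>i. (i, Suc i)) ` ({..<n - 1} - {g - 1}))"
    "(0, g) \<notin> (\<lambda>i. (i, Suc i)) ` ({..<n - 1} - {g - 1})"
    using assms by auto
  then have "sum F (pendant_arcs n g) =
      F (g - 1, 0) + (F (0, g) + sum F ((\<lambda>i. (i, Suc i)) ` ({..<n - 1} - {g - 1})))"
    unfolding pendant_arcs_def by (simp add: insert_commute add.left_commute)
  also have "sum F ((\<lambda>i. (i, Suc i)) ` ({..<n - 1} - {g - 1})) = (\<Sum>i\<in>{..<n - 1} - {g - 1}. F (i, Suc i))"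
    by (subst sum.reindex) (auto simp: inj_on_def)
  finally show ?thesis .
qed

lemma card_pendant_arcs:
  assumes "3 \<le> g" "g < n"
  shows "card (pendant_arcs n g) = n"
  using sum_pendant_arcs[OF assms, of "\<lambda>_. 1::nat"] assms by (simp add: card_Diff_singleton)

text \<open>No edge is listed in both directions, so a cardinality or a symmetric sum over all arcs
  is twice that over \<open>pendant_arcs\<close>.\<close>

lemma pendant_arcs_antisym:
  assumes "3 \<le> g"
  shows "pendant_arcs n g \<inter> (pendant_arcs n g)\<inverse> = {}"
  unfolding pendant_arcs_def using assms by auto

lemma finite_pendant_arcs: "finite (pendant_arcs n g)"
  by (simp add: pendant_arcs_def)

lemma card_parcs_cycle_pendant_path:
  assumes "3 \<le> g" "g < n"
  shows "card (parcs (cycle_pendant_path n g)) = 2 * n"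
  using assms pendant_arcs_antisym[of g n]
  by (simp add: cycle_pendant_path_arcs card_Un_disjoint card_pendant_arcs finite_pendant_arcs)

lemma parcs_cycle_pendant_path_subset:
  assumes "3 \<le> g" "g < n"
  shows "parcs (cycle_pendant_path n g) \<subseteq> {..<n} \<times> {..<n}"
  using assms by (auto simp: cycle_pendant_path_arcs pendant_arcs_def)

text \<open>The map \<open>h\<close> runs from the model graph \<open>H\<close> to \<open>G\<close>,
  as an enumeration of the vertices of \<open>G\<close> provides it. The isomorphism is therefore
  built from \<open>H\<close> to \<open>G\<close> and then reversed.\<close>

lemma digraph_isoI:
  assumes "pair_graph G" and h: "bij_betw h (pverts H) (pverts G)"
    and arcs: "map_prod h h ` parcs H = parcs G" and H: "parcs H \<subseteq> pverts H \<times> pverts H"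
  shows "digraph_iso (with_proj G) (with_proj H)"
proof (rule digraph_iso_swap)
  show wf: "wf_digraph (with_proj H)"
    using H by unfold_locales auto
  have inj: "inj_on h (pverts H)"
    using h by (simp add: bij_betw_def)
  then have "inj_on (map_prod h h) (parcs H)"
    using H by (intro inj_on_subset[OF map_prod_inj_on]) auto
  then show "digraph_iso (with_proj H) (with_proj G)"
    unfolding digraph_iso_def app_iso_def
    by (intro exI[of _ "\<lparr>iso_verts = h, iso_arcs = map_prod h h, iso_head = snd, iso_tail = fst\<rparr>"])
      (use wf inj arcs h in \<open>simp add: pre_digraph.digraph_isomorphism_def with_proj_def bij_betw_def\<close>)
qed

section \<open>Recognising a graph from its cycle\<close>

context finite_graph
begin

text \<open>The cycle already has \<open>card V\<close> edges, which are all the edges of the graph,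
  so listing the vertices along it is an isomorphism.\<close>

lemma hamiltonian_cycle_iso:
  assumes cs: "is_cycle E cs" and "length cs = card V" and card: "card (uedges E) = card V"
    shows "bij_betw ((!) cs) {..<card V} V"
    and "map_prod ((!) cs) ((!) cs) ` parcs (cycle_graph (card V)) = E"
proof -
  let ?k = "length cs" and ?A = "cycle_arcs (length cs)"
  have k: "3 \<le> ?k" "distinct cs"
    using cs by (simp_all add: is_cycle_def)
  have "set cs = V"
    using cycle_subset_verts[OF cs] finite_V k assms(2) by (metis card_subset_eq distinct_card)
  then show bij: "bij_betw ((!) cs) {..<card V} V"
    using k assms(2) by (intro bij_betw_nth) auto
  have "map_prod ((!) cs) ((!) cs) ` ?A \<subseteq> E"
    using cs by (auto simp: cycle_arcs_def is_cycle_def)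
  then have sub: "map_prod ((!) cs) ((!) cs) ` (?A \<union> ?A\<inverse>) \<subseteq> E"
    using E_swap by auto
  have "(\<lambda>i. {cs ! i, cs ! (Suc i mod ?k)}) ` {..<?k} \<subseteq> uedges E"
    using cs by (auto simp: is_cycle_def uedges_def)
  then have "(\<lambda>i. {cs ! i, cs ! (Suc i mod ?k)}) ` {..<?k} = uedges E"
    using card_cycle_edges[OF k] assms finite_E by (intro card_subset_eq) (auto simp: uedges_def)
  then have "(u, v) \<in> map_prod ((!) cs) ((!) cs) ` (?A \<union> ?A\<inverse>)" if "(u, v) \<in> E" for u v
  proof -
    assume eq: "(\<lambda>i. {cs ! i, cs ! (Suc i mod ?k)}) ` {..<?k} = uedges E"
    have "{u, v} \<in> uedges E"
      using that by (force simp: uedges_def)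
    then obtain i where i: "i < ?k" "{u, v} = {cs ! i, cs ! (Suc i mod ?k)}"
      unfolding eq[symmetric] by auto
    have "(i, Suc i mod ?k) \<in> ?A"
      using i by (auto simp: cycle_arcs_def)
    then show ?thesis
      using i(2) by (force simp: doubleton_eq_iff)
  qed
  then show "map_prod ((!) cs) ((!) cs) ` parcs (cycle_graph (card V)) = E"
    using sub unfolding cycle_graph_def by (auto simp flip: assms(2))
qed

lemma two_nbrs_eq:
  assumes "N \<subseteq> E `` {v}" "card N = 2" "deg v \<le> 2"
  shows "E `` {v} = N"
  using assms finite_nbrs[of v] by (metis card_seteq)

text \<open>By connectedness some cycle vertex has a neighbour off the cycle, hence three
  neighbours, so it is \<open>u\<close>. Every vertex other than \<open>u\<close> has at most two
  neighbours, so what leaves the cycle is a single unbranched path.\<close>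

lemma pendant_cycle_iso:
  assumes conn: "V \<times> V \<subseteq> E\<^sup>*" and card: "card (uedges E) = card V"
    and cs: "is_cycle E cs" and lt: "length cs < card V"
    and u: "deg u \<le> 3" and deg: "\<And>v. v \<in> V \<Longrightarrow> v \<noteq> u \<Longrightarrow> deg v \<le> 2"
  obtains h where "bij_betw h {..<card V} V"
    and "map_prod h h ` parcs (cycle_pendant_path (card V) (length cs)) = E"
proof -
  have "card (set cs) < card V"
    using lt card_length le_less_trans by blast
  then have "set cs \<noteq> V" "set cs \<noteq> {}"
    using cs by (auto simp: is_cycle_def)
  then obtain c x where cx: "c \<in> set cs" "(c, x) \<in> E" "x \<notin> set cs"
    using closed_set_eq_verts[OF conn cycle_subset_verts[OF cs]] by auto
  have "c = u"
  proof (rule ccontr)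
    assume "c \<noteq> u"
    obtain N where N: "N \<subseteq> E `` {c}" "N \<subseteq> set cs" "card N = 2"
      using cycle_nbrs[OF cs cx(1)] .
    then have "E `` {c} = N"
      using deg \<open>c \<noteq> u\<close> cx cycle_subset_verts[OF cs] by (intro two_nbrs_eq) auto
    then show False
      using cx N by auto
  qed
  then obtain m where m: "m < length cs" "cs ! m = u"
    using cx by (metis in_set_conv_nth)
  define ds where "ds = rotate m cs"
  let ?k = "length ds"
  have ds: "is_cycle E ds" and len: "length ds = length cs"
    using is_cycle_rotate[OF cs] by (simp_all add: ds_def)
  have dsu: "ds ! 0 = u"
    unfolding ds_def m(2)[symmetric] using m(1) by (subst nth_rotate) auto
  have k: "3 \<le> ?k" "distinct ds"
    using ds by (simp_all add: is_cycle_def)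
  have x: "(u, x) \<in> E" "x \<notin> set ds" "u \<in> set ds" "x \<in> V"
    using cx \<open>c = u\<close> E_sub by (auto simp: ds_def)
  \<comment> \<open>A longest path that leaves the cycle at \<open>u\<close> and avoids it afterwards, together with the
    cycle, is closed under adjacency and therefore exhausts the graph.\<close>
  define P where "P xs \<longleftrightarrow> xs \<noteq> [] \<and> distinct (ds @ xs) \<and> set (ds @ xs) \<subseteq> V \<and>
      successively (\<lambda>v w. (v, w) \<in> E) (u # xs)" for xs
  have "P [x]"
    using x k cycle_subset_verts[OF ds] by (auto simp: P_def)
  moreover have "length xs < Suc (card V)" if "P xs" for xs
  proof -
    have "length (ds @ xs) \<le> card V"
      using that card_mono[OF finite_V] distinct_card unfolding P_def by metis
    then show ?thesis
      by simp
  qed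
  then have "\<forall>xs. P xs \<longrightarrow> length xs < Suc (card V)"
    by blast
  ultimately have "\<exists>xs. P xs \<and> (\<forall>ys. P ys \<longrightarrow> length ys \<le> length xs)"
    by (rule ex_has_greatest_nat)
  then obtain xs where xs: "P xs" and max: "\<And>ys. P ys \<Longrightarrow> length ys \<le> length xs"
    by blast
  have ne: "xs \<noteq> []" and dist: "distinct (ds @ xs)" and sub: "set (ds @ xs) \<subseteq> V"
    and path: "successively (\<lambda>v w. (v, w) \<in> E) (u # xs)"
    using xs by (simp_all add: P_def)
  have dist': "distinct (u # xs)"
    using dist x(3) by auto
  \<comment> \<open>\<open>(u # xs) ! j\<close> is the predecessor of \<open>xs ! j\<close> on the
    path, which is \<open>u\<close> itself for \<open>j = 0\<close>.\<close>
  have step: "((u # xs) ! j, xs ! j) \<in> E" if "j < length xs" for j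
    using path that by (auto simp: successively_conv_nth)
  let ?S = "set (ds @ xs)"
  have nbrs_cycle: "E `` {v} \<subseteq> ?S" if "v \<in> set ds" for v
  proof -
    obtain N where N: "N \<subseteq> E `` {v}" "N \<subseteq> set ds" "card N = 2"
      using cycle_nbrs[OF ds \<open>v \<in> set ds\<close>] .
    show ?thesis
    proof (cases "v = u")
      case True
      \<comment> \<open>The two neighbours of \<open>u\<close> on the cycle and the first path
        vertex use up its degree 3.\<close>
      have "hd xs \<notin> set ds"
        using ne dist by (cases xs) auto
      then have "card (insert (hd xs) N) = 3"
        using N by (subst card_insert_disjoint) (auto intro: card_ge_0_finite)
      moreover have "insert (hd xs) N \<subseteq> E `` {v}"
        using N True step[of 0] ne by (auto simp: hd_conv_nth)
      ultimately have "E `` {v} = insert (hd xs) N"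
        using u True finite_nbrs[of v] by (metis card_seteq)
      then show ?thesis
        using N ne by auto
    next
      case False
      then have "E `` {v} = N"
        using N deg that sub by (intro two_nbrs_eq) auto
      then show ?thesis
        using N by auto
    qed
  qed
  have nbrs_inner: "E `` {xs ! j} \<subseteq> ?S" if "Suc j < length xs" for j
  proof -
    let ?N = "{(u # xs) ! j, xs ! Suc j}"
    \<comment> \<open>Predecessor and successor of \<open>xs ! j\<close> are the entries
      \<open>j\<close> and \<open>j + 2\<close> of \<open>u # xs\<close>.\<close>
    have "(u # xs) ! j \<noteq> (u # xs) ! Suc (Suc j)"
      using that by (subst nth_eq_iff_index_eq[OF dist']) auto
    then have "card ?N = 2"
      by simp
    moreover have "?N \<subseteq> E `` {xs ! j}"
      using step[of j] step[of "Suc j"] that E_swap by auto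
    moreover have "xs ! j \<in> V" "xs ! j \<noteq> u"
      using sub dist' that by auto
    ultimately have "E `` {xs ! j} = ?N"
      using deg by (intro two_nbrs_eq) auto
    moreover have "(u # xs) ! j \<in> ?S"
      using that x(3) by (cases j) auto
    ultimately show ?thesis
      using that by auto
  qed
  have nbrs_last: "E `` {last xs} \<subseteq> ?S"
  proof (rule ccontr)
    assume "\<not> E `` {last xs} \<subseteq> ?S"
    then obtain y where "(last xs, y) \<in> E" "y \<notin> ?S"
      by auto
    then have "P (xs @ [y])"
      using ne dist sub path E_sub
      by (auto simp: P_def successively_append_iff successively_Cons)
    then show False
      using max by fastforce
  qed
  have "E `` {v} \<subseteq> ?S" if v: "v \<in> set xs" for v
  proof -
    obtain j where j: "j < length xs" "v = xs ! j"
      using v by (auto simp: in_set_conv_nth)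
    show ?thesis
    proof (cases "Suc j = length xs")
      case True
      then have "v = last xs"
        using j ne by (simp add: last_conv_nth flip: True)
      then show ?thesis
        using nbrs_last by simp
    next
      case False
      then show ?thesis
        using nbrs_inner[of j] j by simp
    qed
  qed
  then have "E `` ?S \<subseteq> ?S"
    using nbrs_cycle by auto
  then have S: "?S = V"
    using closed_set_eq_verts[OF conn sub] ne by auto
  \<comment> \<open>The list \<open>ds @ xs\<close> follows the numbering of
    \<open>cycle_pendant_path\<close>: \<open>u\<close> has index 0 and the path starts at index
    \<open>?k\<close>.\<close>
  let ?n = "card V" and ?h = "(!) (ds @ xs)"
  have n: "?n = ?k + length xs"
    unfolding S[symmetric] using distinct_card[OF dist] by simp
  have bij: "bij_betw ?h {..<?n} V"
    using dist S n by (intro bij_betw_nth) auto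
  have kn: "3 \<le> ?k" "?k < ?n"
    using k n ne by auto
  have "(?h i, ?h j) \<in> E" if ij: "(i, j) \<in> pendant_arcs ?n ?k" for i j
  proof -
    have "i = ?k - 1 \<and> j = 0 \<or> i = 0 \<and> j = ?k \<or> Suc i < ?k \<and> j = Suc i \<or>
        ?k \<le> i \<and> Suc i < ?n \<and> j = Suc i"
      using ij by (auto simp: pendant_arcs_def)
    then
    consider "i = ?k - 1" "j = 0" | "i = 0" "j = ?k" | "Suc i < ?k" "j = Suc i"
      | "?k \<le> i" "Suc i < ?n" "j = Suc i"
      by blast
    then show ?thesis
    proof cases
      case 1
      have "(ds ! (?k - 1), ds ! (Suc (?k - 1) mod ?k)) \<in> E"
        using ds k unfolding is_cycle_def by (metis diff_less less_le_trans zero_less_numeral zero_less_one)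
      then show ?thesis
        using 1 k by (auto simp: nth_append)
    next
      case 2
      then show ?thesis
        using step[of 0] dsu k ne by (auto simp: nth_append)
    next
      case 3
      then have "(ds ! i, ds ! (Suc i mod ?k)) \<in> E"
        using ds unfolding is_cycle_def by (meson Suc_lessD)
      then show ?thesis
        using 3 by (simp add: nth_append)
    next
      case 4
      then show ?thesis
        using step[of "Suc (i - ?k)"] n by (simp add: nth_append Suc_diff_le)
    qed
  qed
  then have sub_E: "map_prod ?h ?h ` parcs (cycle_pendant_path ?n ?k) \<subseteq> E"
    using kn E_swap by (auto simp: cycle_pendant_path_arcs)
  \<comment> \<open>Injectivity leaves the image with \<open>2 * ?n\<close> arcs, as many as
    \<open>E\<close> has, which turns the inclusion into an equality.\<close>
  have "inj_on (map_prod ?h ?h) (parcs (cycle_pendant_path ?n ?k))"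
    using bij parcs_cycle_pendant_path_subset[OF kn]
    by (intro inj_on_subset[OF map_prod_inj_on]) (auto simp: bij_betw_def)
  then have "card (map_prod ?h ?h ` parcs (cycle_pendant_path ?n ?k)) = card E"
    using kn card card_arcs by (simp add: card_image card_parcs_cycle_pendant_path)
  then have "map_prod ?h ?h ` parcs (cycle_pendant_path ?n ?k) = E"
    using sub_E finite_E by (simp add: card_subset_eq)
  then show thesis
    using that bij len by simp
qed

end

section \<open>Girth of unicyclic graphs\<close>

lemma degree_eq: "degree G v = card (parcs G `` {v})"
proof -
  have "out_arcs (with_proj G) v = Pair v ` (parcs G `` {v})"
    by auto
  then show ?thesis
    by (simp add: out_degree_def card_image inj_on_def)
qed

lemma pair_graph_finite_graph:
  assumes "pair_graph G"
  shows "finite_graph (pverts G) (parcs G)"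
proof -
  interpret pair_graph G
    by fact
  show ?thesis
    using pair_finite_verts wellformed' arcs_symmetric
    by unfold_locales (auto simp: sym_def irrefl_def dest: no_loops')
qed

lemma is_cycle_zip_rotate1:
  "is_cycle E cs \<longleftrightarrow> 3 \<le> length cs \<and> distinct cs \<and> set (zip cs (rotate1 cs)) \<subseteq> E"
  by (auto simp: is_cycle_def set_zip nth_rotate1)

lemma pcas_iff: "pcas u p v \<longleftrightarrow> map fst p @ [v] = u # map snd p"
  by (induction p arbitrary: u) auto

lemma pawalk_verts_pcas: "pcas u p v \<Longrightarrow> pawalk_verts u p = u # map snd p"
  by (induction p arbitrary: u) auto

text \<open>A cycle given by its arcs passes to the list of their tails; conversely, the arcs of
  \<open>cs\<close> are the entries of \<open>zip cs (rotate1 cs)\<close>.\<close>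

lemma undirected_cycle_iff:
  assumes "pair_graph G"
  shows "(\<exists>p. undirected_cycle G p \<and> length p = k) \<longleftrightarrow> (\<exists>cs. is_cycle (parcs G) cs \<and> length cs = k)"
proof
  interpret pair_graph G
    by fact
  {
    assume "\<exists>p. undirected_cycle G p \<and> length p = k"
    then obtain p u where p: "set p \<subseteq> parcs G" "3 \<le> length p" "length p = k"
      and "pcas u p u" "distinct (tl (pawalk_verts u p))"
      by (auto simp: undirected_cycle_def cycle_def awalk_def)
    then have walk: "map fst p @ [u] = u # map snd p" and dist: "distinct (map snd p)"
      by (simp_all only: pcas_iff pawalk_verts_pcas list.sel)
    then have rot: "map snd p = rotate1 (map fst p)"
      by (cases "map fst p") auto
    then have "zip (map fst p) (rotate1 (map fst p)) = p"
      by (metis zip_map_fst_snd)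
    moreover have "distinct (map fst p)"
      using dist rot by simp
    ultimately show "\<exists>cs. is_cycle (parcs G) cs \<and> length cs = k"
      using p by (intro exI[of _ "map fst p"]) (auto simp: is_cycle_zip_rotate1)
  next
    assume "\<exists>cs. is_cycle (parcs G) cs \<and> length cs = k"
    then obtain cs where cs: "3 \<le> length cs" "distinct cs" "set (zip cs (rotate1 cs)) \<subseteq> parcs G"
      "length cs = k"
      by (auto simp: is_cycle_zip_rotate1)
    let ?p = "zip cs (rotate1 cs)" and ?u = "hd cs"
    have "pcas ?u ?p ?u"
      using cs(1) by (cases cs) (auto simp: pcas_iff)
    moreover have "?u \<in> pverts G"
    proof -
      have "?p \<noteq> []" "fst (hd ?p) = ?u"
        using cs(1) by (cases cs; cases "tl cs"; simp)+
      then show ?thesis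
        using cs(3) by (metis hd_in_set in_mono pair_fin_digraph.axioms(1) pair_wf_digraph.arc_fst_in_verts pair_fin_digraph)
    qed
    ultimately have "undirected_cycle G ?p"
      using cs by (auto simp: undirected_cycle_def cycle_def awalk_def pawalk_verts_pcas
          intro!: exI[of _ ?u])
    then show "\<exists>p. undirected_cycle G p \<and> length p = k"
      using cs(4) by (intro exI[of _ ?p]) simp
  }
qed

lemma connected_rtrancl:
  assumes "pair_graph G" "connected (with_proj G)"
  shows "pverts G \<times> pverts G \<subseteq> (parcs G)\<^sup>*" "pverts G \<noteq> {}"
proof -
  interpret pair_graph G
    by fact
  \<comment> \<open>\<open>connected\<close> is defined through the symmetric closure, which adds
    nothing to a symmetric graph.\<close>
  have "parcs (mk_symmetric (with_proj G)) = parcs G"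
    using adj_mk_symmetric_eq[OF pair_sym_arcs] by simp
  then have "strongly_connected (with_proj (mk_symmetric (with_proj G))) \<longleftrightarrow> pverts G \<noteq> {} \<and>
      (\<forall>u\<in>pverts G. \<forall>v\<in>pverts G. (u, v) \<in> rtrancl_on (pverts G) (parcs G))"
    by (simp add: strongly_connected_def reachable_def)
  then show "pverts G \<times> pverts G \<subseteq> (parcs G)\<^sup>*" "pverts G \<noteq> {}"
    using assms(2) by (auto simp: connected_def intro: rtrancl_on_rtranclI)
qed

text \<open>\<open>girth\<close> is a definite description: the edge count makes a cycle exist, and
  comparing two cycles both ways makes the length unique.\<close>

lemma girth_cycle:
  assumes "unicyclic G"
  shows "\<exists>cs. is_cycle (parcs G) cs \<and> length cs = girth G"
proof -
  have G: "pair_graph G" "connected (with_proj G)" and card: "card (uedges (parcs G)) = card (pverts G)"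
    using assms by (simp_all add: unicyclic_def edges_def uedges_def)
  interpret finite_graph "pverts G" "parcs G"
    by (rule pair_graph_finite_graph) fact
  note conn = connected_rtrancl[OF G]
  obtain cs where "is_cycle (parcs G) cs"
    using cycle_exists[OF finite_graph_axioms conn(2)] card by auto
  then have "\<exists>!k. \<exists>cs. is_cycle (parcs G) cs \<and> length cs = k"
    using unicyclic_cycle_length_le[OF conn] card by (metis le_antisym order_refl)
  then show ?thesis
    unfolding girth_def undirected_cycle_iff[OF G(1)] by (rule theI')
qed

section \<open>The Euler Sombor index\<close>

definition edge_weight :: "nat \<Rightarrow> nat \<Rightarrow> real" where
  "edge_weight a b = sqrt ((real a)\<^sup>2 + (real b)\<^sup>2 + real a * real b)"

lemma edge_weight_commute: "edge_weight a b = edge_weight b a"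
  by (simp add: edge_weight_def add.commute mult.commute)

lemma edge_weight_ge: "edge_weight a b \<ge> sqrt 3 / 2 * (real a + real b)"
proof -
  have "(sqrt 3 / 2 * (real a + real b))\<^sup>2 = 3 / 4 * (real a + real b)\<^sup>2"
    by (simp add: power_mult_distrib power_divide)
  \<comment> \<open>The gap in the squared inequality is exactly a quarter of the squared difference
    of the degrees.\<close>
  also have "\<dots> = (real a)\<^sup>2 + (real b)\<^sup>2 + real a * real b - (real a - real b)\<^sup>2 / 4"
    by (simp add: power2_eq_square field_simps)
  finally show ?thesis
    unfolding edge_weight_def by (intro real_le_rsqrt) simp
qed

lemma edge_weight_2_2: "edge_weight 2 2 = 2 * sqrt 3"
proof -
  have "edge_weight 2 2 = sqrt (2\<^sup>2 * 3)"
    by (simp add: edge_weight_def)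
  then show ?thesis
    by (simp only: real_sqrt_mult real_sqrt_abs abs_numeral)
qed

lemma EUS_sum_arcs:
  assumes "pair_graph G"
  shows "2 * EUS G = (\<Sum>(u, v)\<in>parcs G. edge_weight (degree G u) (degree G v))"
proof -
  interpret finite_graph "pverts G" "parcs G"
    by (rule pair_graph_finite_graph) fact
  let ?h = "\<lambda>e. sqrt ((\<Sum>v\<in>e. (real (degree G v))\<^sup>2) + (\<Prod>v\<in>e. real (degree G v)))"
  have "2 * EUS G = (\<Sum>(u, v)\<in>parcs G. ?h {u, v})"
    by (simp only: sum_arcs_edges[of ?h] EUS_def edges_def uedges_def)
  also have "\<dots> = (\<Sum>(u, v)\<in>parcs G. edge_weight (degree G u) (degree G v))"
    by (intro sum.cong) (auto simp: edge_weight_def dest: E_neq)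
  finally show ?thesis .
qed

text \<open>Supplies the direction from isomorphism to equality, reducing it to the value on an
  explicit graph.\<close>

lemma EUS_iso:
  assumes "pair_graph G" "pair_graph H" and iso: "digraph_iso (with_proj G) (with_proj H)"
  shows "EUS G = EUS H"
proof -
  interpret G: pair_graph G
    by fact
  obtain f where f: "pre_digraph.digraph_isomorphism (with_proj G) f" and H: "with_proj H = app_iso f (with_proj G)"
    using iso by (auto simp: digraph_iso_def)
  have arcs: "parcs H = iso_arcs f ` parcs G" and ends: "fst = iso_tail f" "snd = iso_head f"
    using arg_cong[OF H, of arcs] arg_cong[OF H, of tail] arg_cong[OF H, of head] by simp_all
  have e: "fst (iso_arcs f a) = iso_verts f (fst a)" "snd (iso_arcs f a) = iso_verts f (snd a)"
    if "a \<in> parcs G" for a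
    using f that ends by (auto simp: pre_digraph.digraph_isomorphism_def)
  have inj: "inj_on (iso_arcs f) (parcs G)"
    using f by (auto simp: pre_digraph.digraph_isomorphism_def)
  have deg: "degree H (iso_verts f v) = degree G v" if "v \<in> pverts G" for v
    unfolding H using G.out_degree_app_iso_eq[OF f that] .
  have "2 * EUS H = (\<Sum>a\<in>parcs G. edge_weight (degree H (fst (iso_arcs f a))) (degree H (snd (iso_arcs f a))))"
    unfolding EUS_sum_arcs[OF assms(2)] arcs by (subst sum.reindex[OF inj]) (simp add: case_prod_unfold)
  also have "\<dots> = (\<Sum>a\<in>parcs G. edge_weight (degree G (fst a)) (degree G (snd a)))"
    by (intro sum.cong) (auto simp: e deg G.arc_fst_in_verts G.arc_snd_in_verts)
  finally show ?thesis
    using EUS_sum_arcs[OF assms(1)] by (simp add: case_prod_unfold)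
qed

lemma EUS_ge_sum_degree_squares:
  assumes "pair_graph G"
  shows "EUS G \<ge> sqrt 3 / 2 * (\<Sum>v\<in>pverts G. (real (degree G v))\<^sup>2)"
proof -
  interpret finite_graph "pverts G" "parcs G"
    by (rule pair_graph_finite_graph) fact
  have fst: "(\<Sum>(u, v)\<in>parcs G. real (deg u)) = (\<Sum>v\<in>pverts G. (real (deg v))\<^sup>2)"
    by (simp add: sum_arcs_fst power2_eq_square)
  \<comment> \<open>Reversing the arcs exchanges heads and tails, so the degree sums of both ends
    add up to twice the sum of squares.\<close>
  have "(\<Sum>(u, v)\<in>parcs G. real (deg v)) = (\<Sum>(u, v)\<in>parcs G. real (deg u))"
    by (rule sum.reindex_bij_witness[of _ prod.swap prod.swap]) (auto simp: E_swap)
  then have "sqrt 3 * (\<Sum>v\<in>pverts G. (real (deg v))\<^sup>2) =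
      (\<Sum>(u, v)\<in>parcs G. sqrt 3 / 2 * (real (deg u) + real (deg v)))"
    using fst by (simp add: case_prod_unfold sum.distrib flip: sum_distrib_left sum_divide_distrib)
  also have "\<dots> \<le> (\<Sum>(u, v)\<in>parcs G. edge_weight (deg u) (deg v))"
    by (intro sum_mono) (auto intro: edge_weight_ge[simplified])
  also have "\<dots> = 2 * EUS G"
    by (simp add: EUS_sum_arcs[OF assms] degree_eq)
  finally show ?thesis
    by (simp add: degree_eq)
qed

section \<open>The index of a cycle with a pendant path\<close>

lemma pendant_path_nbrs:
  assumes "3 \<le> g" "g < n" "i < n"
  shows "parcs (cycle_pendant_path n g) `` {i} =
    (if i = 0 then {1, g - 1, g} else if i = g - 1 then {i - 1, 0}
     else if i = g then (if Suc g < n then {0, Suc g} else {0})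
     else if Suc i < n then {i - 1, Suc i} else {i - 1})"
proof -
  have iff: "(i, j) \<in> parcs (cycle_pendant_path n g) \<longleftrightarrow>
    i = g - 1 \<and> j = 0 \<or> i = 0 \<and> j = g \<or> j = Suc i \<and> Suc i < n \<and> i \<noteq> g - 1 \<or>
    j = g - 1 \<and> i = 0 \<or> j = 0 \<and> i = g \<or> i = Suc j \<and> j \<noteq> g - 1" for j
    using assms by (auto simp: cycle_pendant_path_arcs pendant_arcs_def image_iff)
  \<comment> \<open>This form makes 0, 1, \<open>g - 1\<close> and \<open>g\<close> visibly
    distinct.\<close>
  obtain m where g: "g = Suc (Suc (Suc m))"
    using assms(1) by (metis add_Suc le_Suc_ex numeral_3_eq_3 plus_nat.add_0)
  have E: "parcs (cycle_pendant_path n g) `` {i} = {j. (i, j) \<in> parcs (cycle_pendant_path n g)}"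
    by auto
  consider "i = 0" | "i = g - 1" | "i = g" | l where "i = Suc l" "i \<noteq> g - 1" "i \<noteq> g"
    by (metis not0_implies_Suc)
  then show ?thesis
  proof cases
    case 1
    show ?thesis
      unfolding E iff unfolding 1 g using assms(2) g by auto
  next
    case 2
    show ?thesis
      unfolding E iff unfolding 2 g using assms(2) g by auto
  next
    case 3
    show ?thesis
      unfolding E iff unfolding 3 g using assms(2) g by auto
  next
    case 4
    show ?thesis
      using 4(2,3) unfolding E iff unfolding 4(1) g by auto
  qed
qed

lemma degree_cycle_pendant_path:
  assumes "3 \<le> g" "g < n" "i < n"
  shows "degree (cycle_pendant_path n g) i = (if i = 0 then 3 else if i = n - 1 then 1 else 2)"
  using assms by (auto simp: degree_eq pendant_path_nbrs card_insert_if)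

lemma EUS_cycle_pendant_path_sum:
  assumes "3 \<le> g" "g < n"
  shows "EUS (cycle_pendant_path n g) =
    (\<Sum>(i, j)\<in>pendant_arcs n g.
      edge_weight (degree (cycle_pendant_path n g) i) (degree (cycle_pendant_path n g) j))"
proof -
  let ?P = "pendant_arcs n g" and ?d = "degree (cycle_pendant_path n g)"
  have "(\<Sum>(i, j)\<in>?P\<inverse>. edge_weight (?d i) (?d j)) = (\<Sum>(i, j)\<in>?P. edge_weight (?d i) (?d j))"
    by (rule sum.reindex_bij_witness[of _ prod.swap prod.swap]) (auto simp: edge_weight_commute)
  then have "2 * EUS (cycle_pendant_path n g) = 2 * (\<Sum>(i, j)\<in>?P. edge_weight (?d i) (?d j))"
    unfolding EUS_sum_arcs[OF pair_graph_cycle_pendant_path[OF assms]]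
    using assms pendant_arcs_antisym[of g n]
    by (simp add: cycle_pendant_path_arcs sum.union_disjoint finite_pendant_arcs)
  then show ?thesis
    by simp
qed

text \<open>The vertex of degree 3 has two neighbours of degree 2 and the leaf; the other
  \<open>n - 3\<close> edges join vertices of degree 2.\<close>

lemma EUS_cycle_pendant_path_single:
  assumes "4 \<le> n"
  shows "EUS (cycle_pendant_path n (n - 1)) = 2 * sqrt 3 * (real n - 3) + 2 * sqrt 19 + sqrt 13"
proof -
  have g: "3 \<le> n - 1" "n - 1 < n"
    using assms by auto
  let ?d = "degree (cycle_pendant_path n (n - 1))"
  have d: "?d 0 = 3" "?d (n - 1) = 1" "\<And>i. 0 < i \<Longrightarrow> i < n - 1 \<Longrightarrow> ?d i = 2"
    using degree_cycle_pendant_path[OF g] assms by auto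
  have "{..<n - 1} - {n - 1 - 1} = insert 0 {1..<n - 2}"
    using assms by auto
  then have "EUS (cycle_pendant_path n (n - 1)) =
      edge_weight (?d (n - 1 - 1)) (?d 0) + (edge_weight (?d 0) (?d (n - 1)) +
        (edge_weight (?d 0) (?d 1) + (\<Sum>i\<in>{1..<n - 2}. edge_weight (?d i) (?d (Suc i)))))"
    unfolding EUS_cycle_pendant_path_sum[OF g] sum_pendant_arcs[OF g] by simp
  also have "(\<Sum>i\<in>{1..<n - 2}. edge_weight (?d i) (?d (Suc i))) = (\<Sum>i\<in>{1..<n - 2}. 2 * sqrt 3)"
  proof (rule sum.cong)
    fix i assume "i \<in> {1..<n - 2}"
    then show "edge_weight (?d i) (?d (Suc i)) = 2 * sqrt 3"
      by (subst (1 2) d(3)) (auto simp: edge_weight_2_2)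
  qed simp
  also have "edge_weight (?d (n - 1 - 1)) (?d 0) = sqrt 19"
    using assms by (subst d(1), subst d(3)) (auto simp: edge_weight_def)
  also have "edge_weight (?d 0) (?d (n - 1)) = sqrt 13"
    by (simp only: d) (simp add: edge_weight_def)
  also have "edge_weight (?d 0) (?d 1) = sqrt 19"
    using assms by (subst d(1), subst d(3)) (auto simp: edge_weight_def)
  finally show ?thesis
    using assms by (simp add: of_nat_diff algebra_simps)
qed

text \<open>All three neighbours of vertex 0 have degree 2, and the leaf hangs on a vertex of degree
  2, which contributes \<open>sqrt 7\<close>. The other \<open>n - 4\<close> edges join vertices of
  degree 2.\<close>

lemma EUS_cycle_pendant_path_long:
  assumes "3 \<le> g" "g + 2 \<le> n"
  shows "EUS (cycle_pendant_path n g) = 3 * sqrt 19 + 2 * (real n - 4) * sqrt 3 + sqrt 7"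
proof -
  have g: "3 \<le> g" "g < n"
    using assms by auto
  let ?d = "degree (cycle_pendant_path n g)" and ?I = "{1..<n - 2} - {g - 1}"
  have d: "?d 0 = 3" "?d (n - 1) = 1" "\<And>i. 0 < i \<Longrightarrow> i < n - 1 \<Longrightarrow> ?d i = 2"
    using degree_cycle_pendant_path[OF g] g by auto
  \<comment> \<open>The index 0 belongs to an edge at the vertex of degree 3 and
    \<open>n - 2\<close> to the edge at the leaf; \<open>g + 2 \<le> n\<close> keeps
    \<open>n - 2\<close> apart from \<open>g - 1\<close>.\<close>
  have "{..<n - 1} - {g - 1} = insert 0 (insert (n - 2) ?I)" "n - 2 \<noteq> 0"
    using assms by auto
  then have "EUS (cycle_pendant_path n g) =
      edge_weight (?d (g - 1)) (?d 0) + (edge_weight (?d 0) (?d g) +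
        (edge_weight (?d 0) (?d 1) + (edge_weight (?d (n - 2)) (?d (Suc (n - 2))) +
          (\<Sum>i\<in>?I. edge_weight (?d i) (?d (Suc i))))))"
    unfolding EUS_cycle_pendant_path_sum[OF g] sum_pendant_arcs[OF g] by simp
  also have "(\<Sum>i\<in>?I. edge_weight (?d i) (?d (Suc i))) = (\<Sum>i\<in>?I. 2 * sqrt 3)"
  proof (rule sum.cong)
    fix i assume "i \<in> ?I"
    then show "edge_weight (?d i) (?d (Suc i)) = 2 * sqrt 3"
      by (subst (1 2) d(3)) (auto simp: edge_weight_2_2)
  qed simp
  also have "(\<Sum>i\<in>?I. 2 * sqrt 3) = (real n - 4) * (2 * sqrt 3)"
  proof -
    have "card ?I = n - 4"
      using assms by (subst card_Diff_singleton) auto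
    then show ?thesis
      using assms by (simp only: sum_constant) (simp add: of_nat_diff)
  qed
  also have "edge_weight (?d (g - 1)) (?d 0) = sqrt 19"
    using assms by (subst d(1), subst d(3)) (auto simp: edge_weight_def)
  also have "edge_weight (?d 0) (?d g) = sqrt 19"
    using assms by (subst d(1), subst d(3)) (auto simp: edge_weight_def)
  also have "edge_weight (?d 0) (?d 1) = sqrt 19"
    using assms by (subst d(1), subst d(3)) (auto simp: edge_weight_def)
  also have "Suc (n - 2) = n - 1"
    using assms by simp
  also have "edge_weight (?d (n - 2)) (?d (n - 1)) = sqrt 7"
    using assms by (subst d(2), subst d(3)) (auto simp: edge_weight_def)
  finally show ?thesis
    by (simp add: algebra_simps)
qed

text \<open>Since the \<open>x v\<close> sum to \<open>0\<close>, the sum of squares is also the sum of the terms \<open>x v * (x v + 1)\<close>,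
  which are nonnegative, at least \<open>2\<close> if \<open>x v\<close> is positive, and at least \<open>6\<close> if \<open>x v\<close> exceeds \<open>1\<close>.\<close>

lemma at_most_one_positive:
  fixes x :: "'a \<Rightarrow> int"
  assumes "finite V" "V \<noteq> {}" and sum: "(\<Sum>v\<in>V. x v) = 0" and sq: "(\<Sum>v\<in>V. (x v)\<^sup>2) < 4"
  shows "\<exists>u\<in>V. x u \<le> 1 \<and> (\<forall>v\<in>V. v \<noteq> u \<longrightarrow> x v \<le> 0)"
proof (cases "\<forall>v\<in>V. x v \<le> 0")
  case True
  then show ?thesis
    using assms(2) by force
next
  case False
  then obtain u where u: "u \<in> V" "1 \<le> x u"
    by force
  define y where "y v = x v * (x v + 1)" for v
  have y: "0 \<le> y v" for v
    by (cases "0 \<le> x v") (auto simp: y_def zero_le_mult_iff)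
  \<comment> \<open>The total 4 is reached by \<open>a = 1\<close> at two vertices or by
    \<open>a = 2\<close> at one.\<close>
  have y1: "2 * a \<le> y v" if "a \<le> x v" "1 \<le> a" for v a
    unfolding y_def using that mult_mono[of a "x v" 2 "x v + 1"] by linarith
  have "(\<Sum>v\<in>V. y v) < 4"
    using sum sq by (simp add: y_def algebra_simps sum.distrib power2_eq_square)
  then have *: "y u + (\<Sum>v\<in>V - {u}. y v) < 4"
    using assms(1) u by (simp add: sum.remove)
  have "x v \<le> 0" if "v \<in> V" "v \<noteq> u" for v
  proof (rule ccontr)
    assume "\<not> x v \<le> 0"
    moreover have "y v \<le> (\<Sum>v\<in>V - {u}. y v)"
      using that assms(1) y by (intro member_le_sum) auto
    ultimately show False
      using * y1[of 1 v] y1[of 1 u] u by simp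
  qed
  moreover have "x u \<le> 1"
    using * y1[of 2 u] sum_nonneg[of "V - {u}" y] y by force
  ultimately show ?thesis
    using u by blast
qed

section \<open>The bounds and their equality cases\<close>

lemma EUS_hamiltonian_cycle:
  assumes G: "pair_graph G" and cs: "is_cycle (parcs G) cs" and len: "length cs = card (pverts G)"
    and card: "card (edges G) = card (pverts G)"
  shows "EUS G = 2 * sqrt 3 * real (card (pverts G))"
proof -
  interpret finite_graph "pverts G" "parcs G"
    by (rule pair_graph_finite_graph) fact
  have card': "card (uedges (parcs G)) = card (pverts G)"
    using card by (simp add: edges_def uedges_def)
  have "set cs = pverts G"
    using cycle_subset_verts[OF cs] finite_V cs len
    by (metis card_subset_eq distinct_card is_cycle_def)
  then have ge: "2 \<le> deg v" if "v \<in> pverts G" for v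
    using that cycle_nbrs[OF cs] by (metis card_mono finite_nbrs)
  \<comment> \<open>No subtraction is truncated, since every vertex lies on the cycle; as the sum
    vanishes, each degree is exactly 2.\<close>
  have "(\<Sum>v\<in>pverts G. deg v - 2) = 0"
    using sum_subtractf_nat[of "pverts G" "\<lambda>_. 2" deg] ge sum_deg card' by simp
  then have "deg v = 2" if "v \<in> pverts G" for v
    using ge[OF that] that finite_V by (auto simp: sum_eq_0_iff)
  then have "2 * EUS G = (\<Sum>(u, v)\<in>parcs G. 2 * sqrt 3)"
    unfolding EUS_sum_arcs[OF G] degree_eq using E_sub
    by (intro sum.cong) (auto simp: edge_weight_2_2)
  also have "\<dots> = real (card (parcs G)) * (2 * sqrt 3)"
    by (simp add: case_prod_unfold)
  finally show ?thesis
    using card_arcs card' by simp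
qed

lemma unicyclic_EUS_ge_or_iso:
  assumes "unicyclic G" and g: "girth G < card (pverts G)" "3 \<le> girth G"
  shows "EUS G \<ge> 2 * sqrt 3 * real (card (pverts G)) + 2 * sqrt 3 \<or>
    digraph_iso (with_proj G) (with_proj (cycle_pendant_path (card (pverts G)) (girth G)))"
proof -
  let ?n = "card (pverts G)" and ?g = "girth G"
  have G: "pair_graph G" "connected (with_proj G)"
    and card: "card (uedges (parcs G)) = ?n"
    using assms by (simp_all add: unicyclic_def edges_def uedges_def)
  interpret finite_graph "pverts G" "parcs G"
    by (rule pair_graph_finite_graph) fact
  note conn = connected_rtrancl[OF G]
  obtain cs where cs: "is_cycle (parcs G) cs" "length cs = ?g"
    using girth_cycle[OF assms(1)] by blast
  define x where "x v = int (deg v) - 2" for v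
  have sum_deg_int: "(\<Sum>v\<in>pverts G. int (deg v)) = 2 * int ?n"
    using sum_deg card by (simp flip: of_nat_sum)
  then have sum: "(\<Sum>v\<in>pverts G. x v) = 0"
    by (simp add: x_def sum_subtractf)
  show ?thesis
  proof (cases "(\<Sum>v\<in>pverts G. (x v)\<^sup>2) < 4")
    case True
    then obtain u where "x u \<le> 1" "\<forall>v\<in>pverts G. v \<noteq> u \<longrightarrow> x v \<le> 0"
      using at_most_one_positive[OF finite_V conn(2) sum] by blast
    then have "deg u \<le> 3" "\<And>v. v \<in> pverts G \<Longrightarrow> v \<noteq> u \<Longrightarrow> deg v \<le> 2"
      by (fastforce simp: x_def)+
    then obtain h where h: "bij_betw h {..<?n} (pverts G)"
      "map_prod h h ` parcs (cycle_pendant_path ?n ?g) = parcs G"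
      using pendant_cycle_iso[OF conn(1) card cs(1)] cs(2) g by metis
    moreover have "pverts (cycle_pendant_path ?n ?g) = {..<?n}"
      by (simp add: cycle_pendant_path_def Let_def)
    ultimately have "digraph_iso (with_proj G) (with_proj (cycle_pendant_path ?n ?g))"
      using G g parcs_cycle_pendant_path_subset by (intro digraph_isoI[of G h]) simp_all
    then show ?thesis ..
  next
    case False
    have "(\<Sum>v\<in>pverts G. (x v)\<^sup>2) =
        (\<Sum>v\<in>pverts G. (int (deg v))\<^sup>2) - 4 * (\<Sum>v\<in>pverts G. int (deg v)) + 4 * int ?n"
      by (simp add: x_def power2_diff sum.distrib sum_subtractf sum_distrib_left algebra_simps)
    then have "(\<Sum>v\<in>pverts G. (int (deg v))\<^sup>2) \<ge> 4 * int ?n + 4"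
      using False sum_deg_int by linarith
    then have "real_of_int (\<Sum>v\<in>pverts G. (int (deg v))\<^sup>2) \<ge> real_of_int (4 * int ?n + 4)"
      by (simp only: of_int_le_iff)
    then have "(\<Sum>v\<in>pverts G. (real (deg v))\<^sup>2) \<ge> 4 * real ?n + 4"
      by simp
    then have "sqrt 3 / 2 * (4 * real ?n + 4) \<le> sqrt 3 / 2 * (\<Sum>v\<in>pverts G. (real (deg v))\<^sup>2)"
      by (intro mult_left_mono) simp_all
    also have "\<dots> \<le> EUS G"
      using EUS_ge_sum_degree_squares[OF G(1)] by (simp add: degree_eq)
    finally show ?thesis
      by (simp add: algebra_simps)
  qed
qed

theorem theorem2:
  fixes G :: "'a pair_pre_digraph" and n g :: nat
  assumes "unicyclic G"
    and "card (pverts G) = n"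
    and "n \<ge> 3"
    and "girth G = g"
  shows
    "(g = n \<longrightarrow>
        EUS G \<ge> 2 * sqrt 3 * real n \<and>
        (EUS G = 2 * sqrt 3 * real n \<longleftrightarrow>
          digraph_iso (with_proj G) (with_proj (cycle_graph n)))) \<and>
     (g = n - 1 \<longrightarrow>
        EUS G \<ge> 2 * sqrt 3 * (real n - 3) + 2 * sqrt 19 + sqrt 13 \<and>
        (EUS G = 2 * sqrt 3 * (real n - 3) + 2 * sqrt 19 + sqrt 13 \<longleftrightarrow>
          digraph_iso (with_proj G) (with_proj (cycle_pendant_path n (n - 1))))) \<and>
     (g \<le> n - 2 \<longrightarrow>
        EUS G \<ge> 3 * sqrt 19 + 2 * (real n - 4) * sqrt 3 + sqrt 7 \<and>
        (EUS G = 3 * sqrt 19 + 2 * (real n - 4) * sqrt 3 + sqrt 7 \<longleftrightarrow>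
          digraph_iso (with_proj G) (with_proj (cycle_pendant_path n g))))"
proof -
  have G: "pair_graph G" and card: "card (edges G) = n"
    using assms by (simp_all add: unicyclic_def)
  interpret finite_graph "pverts G" "parcs G"
    by (rule pair_graph_finite_graph) fact
  obtain cs where cs: "is_cycle (parcs G) cs" "length cs = g"
    using girth_cycle[OF assms(1)] assms(4) by blast
  then have g3: "3 \<le> g"
    by (simp add: is_cycle_def)
  \<comment> \<open>Common to both cases with \<open>g < n\<close>. As \<open>b\<close> lies
    strictly below the threshold of the dichotomy, a graph that attains \<open>b\<close> must be on
    the isomorphism side.\<close>
  have pendant: "EUS G \<ge> b \<and>
      (EUS G = b \<longleftrightarrow> digraph_iso (with_proj G) (with_proj (cycle_pendant_path n g)))"
    if "g < n" and b: "EUS (cycle_pendant_path n g) = b" "b < 2 * sqrt 3 * real n + 2 * sqrt 3" for b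
  proof -
    have "EUS G = b" if "digraph_iso (with_proj G) (with_proj (cycle_pendant_path n g))"
      using EUS_iso[OF G pair_graph_cycle_pendant_path[OF g3 \<open>g < n\<close>] that] b by simp
    then show ?thesis
      using unicyclic_EUS_ge_or_iso[OF assms(1)] assms(2,4) g3 \<open>g < n\<close> b by auto
  qed
  \<comment> \<open>The two comparisons with the threshold amount to
    \<open>2 * sqrt 19 + sqrt 13 < 8 * sqrt 3\<close> and
    \<open>3 * sqrt 19 + sqrt 7 < 10 * sqrt 3\<close>.\<close>
  have sqrt3: "sqrt 3 \<ge> 1.732"
    by (rule real_le_rsqrt) (simp add: power2_eq_square)
  have sqrt19: "sqrt 19 \<le> 4.36" and sqrt13: "sqrt 13 \<le> 3.61" and sqrt7: "sqrt 7 \<le> 2.65"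
    by (rule real_le_lsqrt; simp add: power2_eq_square)+
  \<comment> \<open>For \<open>g = n\<close> both sides of the equivalence hold outright.\<close>
  have "EUS G = 2 * sqrt 3 * real n \<and> digraph_iso (with_proj G) (with_proj (cycle_graph n))"
    if "g = n"
  proof
    show "EUS G = 2 * sqrt 3 * real n"
      using EUS_hamiltonian_cycle[OF G cs(1)] cs(2) card assms(2) that by simp
    have "parcs (cycle_graph n) \<subseteq> {..<n} \<times> {..<n}"
      using assms(3) by (auto simp: cycle_graph_def cycle_arcs_def)
    then show "digraph_iso (with_proj G) (with_proj (cycle_graph n))"
      using hamiltonian_cycle_iso[OF cs(1)] cs(2) card assms(2) that
      by (intro digraph_isoI[OF G, of "(!) cs"]) (simp_all add: cycle_graph_def edges_def uedges_def)
  qed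
  moreover have "EUS G \<ge> 2 * sqrt 3 * (real n - 3) + 2 * sqrt 19 + sqrt 13 \<and>
        (EUS G = 2 * sqrt 3 * (real n - 3) + 2 * sqrt 19 + sqrt 13 \<longleftrightarrow>
          digraph_iso (with_proj G) (with_proj (cycle_pendant_path n (n - 1))))" if "g = n - 1"
    unfolding that[symmetric]
    using pendant[of "2 * sqrt 3 * (real n - 3) + 2 * sqrt 19 + sqrt 13"]
      EUS_cycle_pendant_path_single[of n] g3 that sqrt3 sqrt19 sqrt13 by (simp add: algebra_simps)
  moreover have "EUS G \<ge> 3 * sqrt 19 + 2 * (real n - 4) * sqrt 3 + sqrt 7 \<and>
        (EUS G = 3 * sqrt 19 + 2 * (real n - 4) * sqrt 3 + sqrt 7 \<longleftrightarrow>
          digraph_iso (with_proj G) (with_proj (cycle_pendant_path n g)))" if "g \<le> n - 2"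
    using pendant[of "3 * sqrt 19 + 2 * (real n - 4) * sqrt 3 + sqrt 7"]
      EUS_cycle_pendant_path_long[of g n] g3 that sqrt3 sqrt19 sqrt7 by (simp add: algebra_simps)
  ultimately show ?thesis
    by simp
qed

end
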